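(* Let $\mathcal{X}$ be an ellipse in the Euclidean plane and let $\mathcal{R}$, $\mathcal{G}$, $P$ and $S$ be such that $\mathcal{R}$ and $\mathcal{G}$ are conics confocal to $\mathcal{X}$, $P$ is a point on $\mathcal{R}$, $S$ is a point on $\mathcal{G}$, and the line $PS$ is tangent to $\mathcal{X}$. Let $M$ be the intersection of the tangent at $P$ to $\mathcal{R}$ and the tangent at $S$ to $\mathcal{G}$. Let $Q$ and $T$ be the touching points of the other tangents from $M$ to $\mathcal{R}$ and $\mathcal{G}$, respectively. Then the lines $QT$, $PT$ and $SQ$ are all tangent to $\mathcal{X}$.
   Context: Two conics are confocal if they have the same foci. Projectively: over the complex projective plane with absolute circle points $\mathsf{I}=(1,i,0)$, $\mathsf{J}=(1,-i,0)$, the foci of a conic (neither degenerate nor a circle) are the four intersections, other than $\mathsf{I},\mathsf{J}$ themselves, of the four tangents from $\mathsf{I}$ and $\mathsf{J}$ to the conic, and two conics share the same foci if these tangents are identical. "The other tangent from $M$ to $\mathcal{R}$" means the tangent from $M$ to $\mathcal{R}$ other than the tangent at $P$; "the other tangent from $M$ to $\mathcal{G}$" means the tangent from $M$ to $\mathcal{G}$ other than the tangent at $S$. *)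

theory Defs
  imports "HOL-Analysis.Analysis"
begin

text \<open>
  Points and lines of the projective plane over a field are represented by nonzero vectors of
  homogeneous coordinates, conics by symmetric matrices; all predicates below are invariant under
  rescaling these representatives. The Euclidean plane is the set of points
  \<open>(x, y, 1)\<close> of the real projective plane, with line at infinity \<open>z = 0\<close>.
\<close>

definition proj_eq :: "'a::field ^ 3 \<Rightarrow> 'a ^ 3 \<Rightarrow> bool" where
  "proj_eq u v \<longleftrightarrow> (\<exists>c. c \<noteq> 0 \<and> u = c *s v)"

definition incident :: "'a::field ^ 3 \<Rightarrow> 'a ^ 3 \<Rightarrow> bool" where
  "incident p l \<longleftrightarrow> p \<noteq> 0 \<and> l \<noteq> 0 \<and> scalar_product p l = 0"

definition is_conic :: "'a::field ^ 3 ^ 3 \<Rightarrow> bool" where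
  "is_conic A \<longleftrightarrow> transpose A = A \<and> det A \<noteq> 0"

definition on_conic :: "'a::field ^ 3 ^ 3 \<Rightarrow> 'a ^ 3 \<Rightarrow> bool" where
  "on_conic A p \<longleftrightarrow> p \<noteq> 0 \<and> scalar_product p (A *v p) = 0"

text \<open>
  Half the gradient of the quadratic form \<open>p\<^sup>T A p\<close>; a line only if \<open>p\<close> is on the conic.
\<close>

definition tangent_at :: "'a::field ^ 3 ^ 3 \<Rightarrow> 'a ^ 3 \<Rightarrow> 'a ^ 3" where
  "tangent_at A p = A *v p"

definition is_tangent :: "'a::field ^ 3 ^ 3 \<Rightarrow> 'a ^ 3 \<Rightarrow> bool" where
  "is_tangent A l \<longleftrightarrow> (\<exists>p. on_conic A p \<and> proj_eq l (tangent_at A p))"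

definition circle_point_I :: "complex ^ 3" where
  "circle_point_I = vector [1, \<i>, 0]"

definition circle_point_J :: "complex ^ 3" where
  "circle_point_J = vector [1, - \<i>, 0]"

definition complexify :: "real ^ 3 ^ 3 \<Rightarrow> complex ^ 3 ^ 3" where
  "complexify A = map_matrix complex_of_real A"

definition tangents_from :: "'a::field ^ 3 ^ 3 \<Rightarrow> 'a ^ 3 \<Rightarrow> ('a ^ 3) set" where
  "tangents_from A p = {l. is_tangent A l \<and> incident p l}"

text \<open>
  The foci are the points of intersection of the isotropic tangents, so equality of these tangents
  is equality of the foci. For a circle the tangents are the two isotropic lines through its
  centre, and being confocal to a circle means being a concentric circle.
\<close>

definition confocal :: "real ^ 3 ^ 3 \<Rightarrow> real ^ 3 ^ 3 \<Rightarrow> bool" where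
  "confocal A B \<longleftrightarrow>
     tangents_from (complexify A) circle_point_I = tangents_from (complexify B) circle_point_I \<and>
     tangents_from (complexify A) circle_point_J = tangents_from (complexify B) circle_point_J"

text \<open>
  A real conic that has real points, none of them at infinity (circles included).
\<close>

definition is_ellipse :: "real ^ 3 ^ 3 \<Rightarrow> bool" where
  "is_ellipse A \<longleftrightarrow> is_conic A \<and> (\<exists>p. on_conic A p) \<and> (\<forall>p. on_conic A p \<longrightarrow> p $ 3 \<noteq> 0)"

text \<open>
  Zero, hence not a line, if the two points coincide; in particular \<open>is_tangent A (join p q)\<close>
  entails that \<open>p\<close> and \<open>q\<close> are different points if \<open>det A \<noteq> 0\<close>.
\<close>

definition join :: "real ^ 3 \<Rightarrow> real ^ 3 \<Rightarrow> real ^ 3" where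
  "join p q = cross3 p q"

text \<open>
  \<open>Q\<close> is the touching point of the tangent from \<open>M\<close> to \<open>A\<close> other than the tangent at \<open>P\<close>.
\<close>

definition other_touching_point ::
  "real ^ 3 ^ 3 \<Rightarrow> real ^ 3 \<Rightarrow> real ^ 3 \<Rightarrow> real ^ 3 \<Rightarrow> bool" where
  "other_touching_point A P M Q \<longleftrightarrow>
     on_conic A Q \<and> incident M (tangent_at A Q) \<and> \<not> proj_eq (tangent_at A Q) (tangent_at A P)"

end

theory Submission
  imports Defs
begin

unbundle cross3_syntax

text \<open>
  Dually, the conics confocal to \<open>X\<close> are the conics of the pencil spanned by \<open>A = X\<inverse>\<close> and
  \<open>D = diag (1, 1, 0)\<close>. Let \<open>p\<close> be the tangent at \<open>P\<close> to \<open>R\<close>, with dual form \<open>A + r D\<close>, and let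
  \<open>n = P \<times> D p\<close> be the normal. Then \<open>p\<close> and \<open>n\<close> are conjugate with respect to \<open>A\<close>, so the
  reflection \<open>\<alpha> p + \<beta> n \<mapsto> \<alpha> p - \<beta> n\<close> of the pencil of lines through \<open>P\<close> preserves tangency
  to \<open>X\<close>. The pole of \<open>p\<close> with respect to any confocal conic \<open>G\<close> lies on \<open>n\<close>, and the chord \<open>ST\<close>
  passes through that pole because \<open>M\<close> lies on \<open>p\<close>; hence \<open>PS\<close> and \<open>PT\<close> are harmonic with
  respect to \<open>p\<close> and \<open>n\<close>, i.e. reflections of each other. Applying this at \<open>P\<close>, \<open>S\<close> and \<open>Q\<close> gives
  the three tangencies. If \<open>R\<close> and \<open>G\<close> coincide, then \<open>Q = S\<close> and \<open>T = P\<close>.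
\<close>

section \<open>Conics and their dual forms\<close>

lemma scalar_product_real: "scalar_product u v = u \<bullet> v" for u v :: "real ^ 'n"
  by (simp add: scalar_product_def inner_vec_def)

lemma scalar_product_commute: "scalar_product u v = scalar_product v u"
  for u v :: "'a::comm_ring_1 ^ 'n"
  by (simp add: scalar_product_def mult.commute)

lemma scalar_product_scale:
  "scalar_product (c *s u) v = c * scalar_product u v"
  "scalar_product u (c *s v) = c * scalar_product u v" for u v :: "'a::comm_ring_1 ^ 'n"
  by (simp_all add: scalar_product_def sum_distrib_left mult_ac)

lemma symmetric_matrix_nth:
  assumes "transpose A = A"
  shows "A $ i $ j = A $ j $ i"
  using arg_cong [OF assms, of "\<lambda>B. B $ i $ j"] by (simp add: transpose_def)

lemma scalar_product_symmetric:
  fixes A :: "'a::comm_ring_1 ^ 'n ^ 'n"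
  assumes "transpose A = A"
  shows "scalar_product u (A *v v) = scalar_product v (A *v u)"
proof -
  have "A $ i $ j = A $ j $ i" for i j
    by (rule symmetric_matrix_nth [OF assms])
  then show ?thesis
    by (simp add: scalar_product_def matrix_vector_mult_def sum_distrib_left mult_ac)
      (subst sum.swap, simp add: mult_ac)
qed

lemma is_conic_inverse:
  fixes A :: "'a::field ^ 3 ^ 3"
  assumes "is_conic A"
  shows "A ** matrix_inv A = mat 1" "matrix_inv A ** A = mat 1"
    "transpose (matrix_inv A) = matrix_inv A"
proof -
  have "invertible A"
    using assms by (simp add: is_conic_def invertible_det_nz)
  then have *: "A ** matrix_inv A = mat 1 \<and> matrix_inv A ** A = mat 1"
    unfolding matrix_inv_def invertible_def by (rule someI_ex)
  then show 1: "A ** matrix_inv A = mat 1" "matrix_inv A ** A = mat 1" by auto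
  have "transpose (matrix_inv A) ** A = mat 1"
    using arg_cong [OF 1(1), of transpose] assms
    by (simp add: matrix_transpose_mul is_conic_def transpose_mat)
  then show "transpose (matrix_inv A) = matrix_inv A"
    by (metis 1(1) matrix_mul_assoc matrix_mul_lid matrix_mul_rid)
qed

lemma is_tangent_dual:
  fixes A B :: "'a::field ^ 3 ^ 3"
  assumes sym: "transpose A = A" and AB: "A ** B = mat 1"
  shows "is_tangent A l \<longleftrightarrow> l \<noteq> 0 \<and> scalar_product l (B *v l) = 0"
proof -
  have BA: "B ** A = mat 1"
    using AB matrix_left_right_inverse1 by blast
  have ABv: "A *v (B *v v) = v" and BAv: "B *v (A *v v) = v" for v
    using AB BA by (simp_all add: matrix_vector_mul_assoc)
  show ?thesis
  proof
    assume "is_tangent A l"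
    then obtain p c where p: "p \<noteq> 0" "scalar_product p (A *v p) = 0" and c: "c \<noteq> 0"
      and l: "l = c *s (A *v p)"
      by (auto simp: is_tangent_def on_conic_def proj_eq_def tangent_at_def)
    have "A *v p \<noteq> 0"
      using p(1) BAv [of p] by auto
    moreover have "B *v l = c *s p"
      by (simp add: l BAv flip: vector_scalar_commute)
    ultimately show "l \<noteq> 0 \<and> scalar_product l (B *v l) = 0"
      using c p(2) by (simp add: l scalar_product_scale scalar_product_commute [of _ p])
  next
    assume l: "l \<noteq> 0 \<and> scalar_product l (B *v l) = 0"
    then have "B *v l \<noteq> 0"
      using ABv [of l] by auto
    then have "on_conic A (B *v l)"
      using l by (simp add: on_conic_def ABv scalar_product_commute)
    moreover have "proj_eq l (tangent_at A (B *v l))"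
      unfolding proj_eq_def tangent_at_def ABv by (rule exI [of _ 1]) simp
    ultimately show "is_tangent A l"
      by (auto simp: is_tangent_def)
  qed
qed

lemma is_tangent_iff:
  fixes l :: "real ^ 3"
  assumes "is_conic X"
  shows "is_tangent X l \<longleftrightarrow> l \<noteq> 0 \<and> l \<bullet> (matrix_inv X *v l) = 0"
  using is_tangent_dual [of X "matrix_inv X" l] assms is_conic_inverse(1) [OF assms]
  by (simp add: is_conic_def scalar_product_real)

lemma is_tangent_complexify:
  assumes "is_conic X"
  shows "is_tangent (complexify X) l \<longleftrightarrow>
    l \<noteq> 0 \<and> scalar_product l (complexify (matrix_inv X) *v l) = 0"
proof (rule is_tangent_dual)
  show "transpose (complexify X) = complexify X"
    using assms by (simp add: is_conic_def complexify_def transpose_def vec_eq_iff)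
  have "(\<Sum>k\<in>UNIV. X $ i $ k * matrix_inv X $ k $ j) = (if i = j then 1 else 0)" for i j
    using arg_cong [OF is_conic_inverse(1) [OF assms], of "\<lambda>Y. Y $ i $ j"]
    by (simp add: matrix_matrix_mult_def mat_def)
  then have "(\<Sum>k\<in>UNIV. complex_of_real (X $ i $ k) * complex_of_real (matrix_inv X $ k $ j))
    = (if i = j then 1 else 0)" for i j
    by (simp flip: of_real_mult of_real_sum)
  then show "complexify X ** complexify (matrix_inv X) = mat 1"
    by (simp add: complexify_def matrix_matrix_mult_def mat_def vec_eq_iff)
qed

lemma ellipse_dual_nonzero:
  assumes "is_ellipse X"
  shows "matrix_inv X $ 3 $ 3 \<noteq> 0"
proof
  let ?B = "matrix_inv X"
  assume B33: "?B $ 3 $ 3 = 0"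
  have con: "is_conic X" using assms by (simp add: is_ellipse_def)
  note inv = is_conic_inverse [OF con]
  let ?v = "?B *v axis 3 1"
  have "X *v ?v = axis 3 1"
    by (simp add: matrix_vector_mul_assoc inv(1))
  moreover have "?v $ 3 = 0"
    using B33 by (simp add: matrix_vector_mult_basis column_def)
  moreover from this have "?v \<bullet> axis 3 1 = 0"
    by (simp add: inner_axis)
  ultimately have "on_conic X ?v"
    by (auto simp: on_conic_def scalar_product_real)
  with assms \<open>?v $ 3 = 0\<close> show False
    by (auto simp: is_ellipse_def)
qed

section \<open>The confocal pencil\<close>

definition isotropic_form :: "real ^ 3 ^ 3" where
  "isotropic_form = vector [vector [1, 0, 0], vector [0, 1, 0], vector [0, 0, 0]]"

lemma isotropic_form_vec: "isotropic_form *v u = vector [u $ 1, u $ 2, 0]"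
  by (simp add: isotropic_form_def vec_eq_iff forall_3 matrix_vector_mult_def sum_3)

lemma isotropic_form_symmetric: "u \<bullet> (isotropic_form *v v) = v \<bullet> (isotropic_form *v u)"
  by (simp add: isotropic_form_vec inner_vec_def sum_3 mult.commute)

lemma monic_quadratic_roots_eq:
  fixes a b c d :: complex
  assumes "\<And>z. z\<^sup>2 + a * z + b = 0 \<longleftrightarrow> z\<^sup>2 + c * z + d = 0"
  shows "a = c \<and> b = d"
proof -
  define w where "w = csqrt (a\<^sup>2 / 4 - b)"
  define v where "v = csqrt (c\<^sup>2 / 4 - d)"
  have w: "w\<^sup>2 = a\<^sup>2 / 4 - b" and v: "v\<^sup>2 = c\<^sup>2 / 4 - d"
    by (simp_all add: w_def v_def)
  have W: "z\<^sup>2 + a * z + b = 0 \<longleftrightarrow> z = - a / 2 + w \<or> z = - a / 2 - w" for z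
  proof -
    have "z\<^sup>2 + a * z + b = (z - (- a / 2 + w)) * (z - (- a / 2 - w))"
      using w by (simp add: field_simps power2_eq_square)
    then show ?thesis by simp
  qed
  have V: "z\<^sup>2 + c * z + d = 0 \<longleftrightarrow> z = - c / 2 + v \<or> z = - c / 2 - v" for z
  proof -
    have "z\<^sup>2 + c * z + d = (z - (- c / 2 + v)) * (z - (- c / 2 - v))"
      using v by (simp add: field_simps power2_eq_square)
    then show ?thesis by simp
  qed
  have "{- a / 2 + w, - a / 2 - w} = {- c / 2 + v, - c / 2 - v}"
    using assms unfolding W V by auto
  then have "- a / 2 + w = - c / 2 + v \<and> - a / 2 - w = - c / 2 - v \<or>
      - a / 2 + w = - c / 2 - v \<and> - a / 2 - w = - c / 2 + v"
    by (simp add: doubleton_eq_iff)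
  moreover have "- a = (- a / 2 + w) + (- a / 2 - w)" "- c = (- c / 2 + v) + (- c / 2 - v)"
    by simp_all
  ultimately have "- a = - c" by (metis add.commute)
  then have ac: "a = c" by simp
  with \<open>_ \<or> _\<close> have "w\<^sup>2 = v\<^sup>2" by auto
  with w v ac show ?thesis by simp
qed

lemma tangents_from_I_iff:
  assumes "is_conic X"
  defines "B \<equiv> \<lambda>i j. complex_of_real (matrix_inv X $ i $ j)"
  shows "vector [- \<i> * y, y, z] \<in> tangents_from (complexify X) circle_point_I \<longleftrightarrow>
    (y \<noteq> 0 \<or> z \<noteq> 0) \<and>
    B 3 3 * z\<^sup>2 + 2 * (B 2 3 - \<i> * B 1 3) * y * z
      + (B 2 2 - B 1 1 - 2 * \<i> * B 1 2) * y\<^sup>2 = 0"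
proof -
  let ?l = "vector [- \<i> * y, y, z] :: complex ^ 3"
  have sym: "matrix_inv X $ i $ j = matrix_inv X $ j $ i" for i j
    by (rule symmetric_matrix_nth [OF is_conic_inverse(3) [OF assms(1)]])
  have "?l \<noteq> 0 \<longleftrightarrow> y \<noteq> 0 \<or> z \<noteq> 0"
    by (auto simp: vec_eq_iff forall_3)
  moreover have "incident circle_point_I ?l \<longleftrightarrow> ?l \<noteq> 0"
    by (simp add: incident_def circle_point_I_def scalar_product_def sum_3)
      (simp add: vec_eq_iff forall_3)
  moreover have "scalar_product ?l (complexify (matrix_inv X) *v ?l) =
      B 3 3 * z\<^sup>2 + 2 * (B 2 3 - \<i> * B 1 3) * y * z
      + (B 2 2 - B 1 1 - 2 * \<i> * B 1 2) * y\<^sup>2"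
    unfolding B_def
    by (simp add: scalar_product_def sum_3 matrix_vector_mult_def complexify_def
        sym [of 2 1] sym [of 3 1] sym [of 3 2] algebra_simps power2_eq_square)
  ultimately show ?thesis
    by (auto simp: tangents_from_def is_tangent_complexify [OF assms(1)])
qed

lemma confocal_pencil:
  assumes "is_conic X" "is_conic R" "confocal R X" and nz: "matrix_inv X $ 3 $ 3 \<noteq> 0"
  obtains k r where "k \<noteq> 0"
    "\<And>u. k *\<^sub>R (matrix_inv R *v u) = matrix_inv X *v u + r *\<^sub>R (isotropic_form *v u)"
proof -
  define A where "A = matrix_inv X"
  define B where "B = matrix_inv R"
  define a where "a i j = complex_of_real (A $ i $ j)" for i j
  define b where "b i j = complex_of_real (B $ i $ j)" for i j
  have symA: "A $ i $ j = A $ j $ i" and symB: "B $ i $ j = B $ j $ i" for i j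
    unfolding A_def B_def
    by (rule symmetric_matrix_nth, rule is_conic_inverse(3), fact)+
  have eq: "(y \<noteq> 0 \<or> z \<noteq> 0) \<and> b 3 3 * z\<^sup>2 + 2 * (b 2 3 - \<i> * b 1 3) * y * z
      + (b 2 2 - b 1 1 - 2 * \<i> * b 1 2) * y\<^sup>2 = 0 \<longleftrightarrow>
      (y \<noteq> 0 \<or> z \<noteq> 0) \<and> a 3 3 * z\<^sup>2 + 2 * (a 2 3 - \<i> * a 1 3) * y * z
      + (a 2 2 - a 1 1 - 2 * \<i> * a 1 2) * y\<^sup>2 = 0" for y z
    using assms(3) tangents_from_I_iff [OF assms(1), of y z] tangents_from_I_iff [OF assms(2), of y z]
    by (simp add: confocal_def a_def b_def A_def B_def)
  have a33: "a 3 3 \<noteq> 0" using nz by (simp add: a_def A_def)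
  then have b33: "b 3 3 \<noteq> 0" using eq [of 0 1] by auto
  define a' where "a' i j = a i j / a 3 3" for i j
  define b' where "b' i j = b i j / b 3 3" for i j
  have "z\<^sup>2 + (2 * (b' 2 3 - \<i> * b' 1 3)) * z + (b' 2 2 - b' 1 1 - 2 * \<i> * b' 1 2) = 0 \<longleftrightarrow>
      z\<^sup>2 + (2 * (a' 2 3 - \<i> * a' 1 3)) * z + (a' 2 2 - a' 1 1 - 2 * \<i> * a' 1 2) = 0" for z
  proof -
    have "b 3 3 * (z\<^sup>2 + (2 * (b' 2 3 - \<i> * b' 1 3)) * z + (b' 2 2 - b' 1 1 - 2 * \<i> * b' 1 2))
      = b 3 3 * z\<^sup>2 + 2 * (b 2 3 - \<i> * b 1 3) * z + (b 2 2 - b 1 1 - 2 * \<i> * b 1 2)"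
      using b33 by (simp add: b'_def field_simps)
    moreover have "a 3 3 * (z\<^sup>2 + (2 * (a' 2 3 - \<i> * a' 1 3)) * z + (a' 2 2 - a' 1 1 - 2 * \<i> * a' 1 2))
      = a 3 3 * z\<^sup>2 + 2 * (a 2 3 - \<i> * a 1 3) * z + (a 2 2 - a 1 1 - 2 * \<i> * a 1 2)"
      using a33 by (simp add: a'_def field_simps)
    ultimately show ?thesis
      using eq [of 1 z] a33 b33 by (metis mult_eq_0_iff mult.right_neutral one_neq_zero power_one)
  qed
  note roots_eq = monic_quadratic_roots_eq [OF this]
  have c: "b' 2 3 - \<i> * b' 1 3 = a' 2 3 - \<i> * a' 1 3"
    "b' 2 2 - b' 1 1 - 2 * \<i> * b' 1 2 = a' 2 2 - a' 1 1 - 2 * \<i> * a' 1 2"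
    using conjunct1 [OF roots_eq] conjunct2 [OF roots_eq] by (simp_all only: mult_cancel_left) simp
  have real: "a' i j = complex_of_real (A $ i $ j / A $ 3 $ 3)"
    "b' i j = complex_of_real (B $ i $ j / B $ 3 $ 3)" for i j
    by (simp_all add: a'_def b'_def a_def b_def)
  define k where "k = A $ 3 $ 3 / B $ 3 $ 3"
  have AB33: "A $ 3 $ 3 \<noteq> 0" "B $ 3 $ 3 \<noteq> 0"
    using a33 b33 by (simp_all add: a_def b_def)
  define r where "r = k * B $ 1 $ 1 - A $ 1 $ 1"
  have kB: "k * B $ i $ j = A $ 3 $ 3 * (B $ i $ j / B $ 3 $ 3)"
    and AA: "A $ 3 $ 3 * (A $ i $ j / A $ 3 $ 3) = A $ i $ j" for i j
    using AB33 by (simp_all add: k_def)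
  have q: "B $ 2 $ 3 / B $ 3 $ 3 = A $ 2 $ 3 / A $ 3 $ 3"
    "B $ 1 $ 3 / B $ 3 $ 3 = A $ 1 $ 3 / A $ 3 $ 3"
    "B $ 1 $ 2 / B $ 3 $ 3 = A $ 1 $ 2 / A $ 3 $ 3"
    "B $ 2 $ 2 / B $ 3 $ 3 = A $ 2 $ 2 / A $ 3 $ 3 + (B $ 1 $ 1 / B $ 3 $ 3 - A $ 1 $ 1 / A $ 3 $ 3)"
    using arg_cong [OF c(1), of Re] arg_cong [OF c(1), of Im]
      arg_cong [OF c(2), of Re] arg_cong [OF c(2), of Im]
    unfolding real by simp_all
  have e: "k * B $ 2 $ 3 = A $ 2 $ 3" "k * B $ 1 $ 3 = A $ 1 $ 3" "k * B $ 1 $ 2 = A $ 1 $ 2"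
    "k * B $ 2 $ 2 = A $ 2 $ 2 + r" "k * B $ 3 $ 3 = A $ 3 $ 3" "k * B $ 1 $ 1 = A $ 1 $ 1 + r"
    unfolding r_def kB q using AB33 by (simp_all add: distrib_left right_diff_distrib AA)
  have "k *\<^sub>R (B *v u) = A *v u + r *\<^sub>R (isotropic_form *v u)" for u
    unfolding isotropic_form_vec vec_eq_iff forall_3
    by (simp add: matrix_vector_mult_def sum_3 symB [of 2 1] symB [of 3 1] symB [of 3 2]
        symA [of 2 1] symA [of 3 1] symA [of 3 2] distrib_left e distrib_right flip: mult.assoc)
  then have "k *\<^sub>R (matrix_inv R *v u) = matrix_inv X *v u + r *\<^sub>R (isotropic_form *v u)" for u
    by (simp only: A_def B_def)
  moreover have "k \<noteq> 0" using AB33 by (simp add: k_def)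
  ultimately show thesis by (intro that)
qed

section \<open>Reflection in the tangent\<close>

lemma concurrent_lines_combination:
  fixes p s t M :: "real ^ 3"
  assumes "M \<noteq> 0" "M \<bullet> p = 0" "M \<bullet> s = 0" "M \<bullet> t = 0" and ps: "p \<times> s \<noteq> 0"
  obtains \<alpha> \<beta> where "t = \<alpha> *\<^sub>R p + \<beta> *\<^sub>R s"
proof -
  define w where "w = p \<times> s"
  have "M \<times> w = 0"
    using assms by (simp add: w_def Lagrange)
  then have "t \<times> (M \<times> w) = 0" by simp
  then have wt: "w \<bullet> t = 0"
    using assms by (simp add: Lagrange inner_commute)
  have "(w \<bullet> w) *\<^sub>R t = w \<times> (t \<times> w)"
    by (simp add: Lagrange wt)
  also have "t \<times> w = (t \<bullet> s) *\<^sub>R p - (t \<bullet> p) *\<^sub>R s"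
    by (simp add: w_def Lagrange)
  also have "w \<times> \<dots> = (t \<bullet> p) *\<^sub>R (s \<times> w) - (t \<bullet> s) *\<^sub>R (p \<times> w)"
    by (simp add: Cross3.right_diff_distrib cross_mult_right cross_skew [of w])
  also have "\<dots> = ((t \<bullet> p) * (s \<bullet> s) - (t \<bullet> s) * (p \<bullet> s)) *\<^sub>R p
      + ((t \<bullet> s) * (p \<bullet> p) - (t \<bullet> p) * (s \<bullet> p)) *\<^sub>R s"
    by (simp add: w_def Lagrange algebra_simps)
  finally have *: "(w \<bullet> w) *\<^sub>R t = \<dots>" .
  have "w \<bullet> w \<noteq> 0" using ps by (simp add: w_def)
  then have "t = (1 / (w \<bullet> w)) *\<^sub>R ((w \<bullet> w) *\<^sub>R t)" by simp
  then show thesis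
    unfolding * scaleR_add_right scaleR_scaleR by (rule that)
qed

lemma cross_eq_0_multiple:
  fixes x y :: "real ^ 3"
  assumes "x \<times> y = 0" "y \<noteq> 0"
  obtains d where "x = d *\<^sub>R y"
proof -
  have "y \<times> (x \<times> y) = 0" using assms by simp
  then have "(y \<bullet> y) *\<^sub>R x = (y \<bullet> x) *\<^sub>R y" by (simp add: Lagrange)
  then have "(1 / (y \<bullet> y)) *\<^sub>R ((y \<bullet> y) *\<^sub>R x) = (1 / (y \<bullet> y)) *\<^sub>R ((y \<bullet> x) *\<^sub>R y)" by simp
  then have "x = ((y \<bullet> x) / (y \<bullet> y)) *\<^sub>R y" using assms(2) by simp
  then show thesis by (rule that)
qed

lemma matrix_vector_mult_minus: "A *v (- x) = - (A *v x)" for A :: "real ^ 'n ^ 'm"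
  by (rule linear_neg [OF matrix_vector_mul_linear])

lemma reflected_chord_tangent:
  fixes A D :: "real ^ 3 ^ 3" and p s t M :: "real ^ 3"
  assumes symA: "\<And>u v. u \<bullet> (A *v v) = v \<bullet> (A *v u)"
    and symD: "\<And>u v. u \<bullet> (D *v v) = v \<bullet> (D *v u)"
    and P: "P = A *v p + r *\<^sub>R (D *v p)" and S: "S = A *v s + g *\<^sub>R (D *v s)"
    and T: "T = A *v t + g *\<^sub>R (D *v t)"
    and on: "p \<bullet> P = 0" "s \<bullet> S = 0" "t \<bullet> T = 0"
    and M: "M \<noteq> 0" "M \<bullet> p = 0" "M \<bullet> s = 0" "M \<bullet> t = 0"
    and ts: "\<And>c. t \<noteq> c *\<^sub>R s"
    and nz: "p \<bullet> (D *v p) \<noteq> 0" and P0: "P \<noteq> 0" and "s \<noteq> 0" and rg: "r \<noteq> g"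
    and l0: "P \<times> S \<noteq> 0" and lX: "(P \<times> S) \<bullet> (A *v (P \<times> S)) = 0"
  shows "P \<times> T \<noteq> 0 \<and> (P \<times> T) \<bullet> (A *v (P \<times> T)) = 0"
proof -
  define c where "c = p \<bullet> (D *v p)"
  define n where "n = P \<times> (D *v p)"
  define h where "h = S \<bullet> n"
  define m where "m = p \<bullet> S"
  have c: "c \<noteq> 0" using nz by (simp add: c_def)
  define N where "N = A *v p + g *\<^sub>R (D *v p)"
  have pole: "N = P + (g - r) *\<^sub>R (D *v p)"
    by (simp add: N_def P algebra_simps)
  have pp: "p \<bullet> N = (g - r) * c"
    using on(1) by (simp add: pole inner_add_right c_def)
  have sp: "s \<bullet> N = m"
    by (simp add: N_def m_def S inner_add_right symA [of s p] symD [of s p])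
  have ps: "p \<times> s \<noteq> 0"
  proof
    assume "p \<times> s = 0"
    then obtain d where d: "p = d *\<^sub>R s"
      using cross_eq_0_multiple \<open>s \<noteq> 0\<close> by blast
    have "N = d *\<^sub>R S"
      by (simp add: N_def d S algebra_simps)
    then have "p \<bullet> N = d * d * (s \<bullet> S)"
      by (simp add: d)
    then show False
      using pp c rg on(2) by simp
  qed
  obtain \<alpha> \<beta> where t: "t = \<alpha> *\<^sub>R p + \<beta> *\<^sub>R s"
    using concurrent_lines_combination [OF M ps] .
  have \<alpha>: "\<alpha> \<noteq> 0" using t ts [of \<beta>] by auto
  have TT: "T = \<alpha> *\<^sub>R N + \<beta> *\<^sub>R S"
    by (simp add: N_def T t S algebra_simps)
  have "t \<bullet> T = \<alpha> * (\<alpha> * ((g - r) * c) + 2 * \<beta> * m)"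
    unfolding TT t
    by (simp add: inner_add_left inner_add_right pp sp on(2) flip: m_def)
      (simp add: algebra_simps)
  with on(3) \<alpha> have \<alpha>\<beta>: "\<alpha> * ((g - r) * c) = - 2 * \<beta> * m" by simp
  have \<beta>: "\<beta> \<noteq> 0" using \<alpha>\<beta> \<alpha> c rg by auto
  have "n \<times> p = - c *\<^sub>R P"
    using on(1) by (simp add: n_def c_def cross_skew [of "P \<times> (D *v p)" p] Lagrange)
  then have np: "n \<times> p \<noteq> 0" using c P0 by simp
  have "c *\<^sub>R (P \<times> S) = S \<times> (n \<times> p)"
    unfolding \<open>n \<times> p = - c *\<^sub>R P\<close> by (simp add: cross_mult_right cross_skew [of P S])
  then have l: "c *\<^sub>R (P \<times> S) = m *\<^sub>R n - h *\<^sub>R p"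
    by (simp add: Lagrange h_def m_def inner_commute)
  have "c *\<^sub>R (P \<times> T) = (\<alpha> * ((g - r) * c)) *\<^sub>R n + \<beta> *\<^sub>R (c *\<^sub>R (P \<times> S))"
    by (simp add: TT pole n_def cross_add_right cross_mult_right scaleR_add_right mult_ac)
  then have l': "c *\<^sub>R (P \<times> T) = - \<beta> *\<^sub>R (m *\<^sub>R n + h *\<^sub>R p)"
    unfolding \<alpha>\<beta> l by (simp add: vec_eq_iff algebra_simps)
  have "n \<bullet> (A *v p) = n \<bullet> P - r * (n \<bullet> (D *v p))"
    by (simp add: P inner_add_right)
  then have np0: "n \<bullet> (A *v p) = 0" "p \<bullet> (A *v n) = 0"
    by (simp_all add: n_def dot_cross_self symA [of p])
  have "(c * c) * ((P \<times> T) \<bullet> (A *v (P \<times> T))) = (c *\<^sub>R (P \<times> T)) \<bullet> (A *v (c *\<^sub>R (P \<times> T)))"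
    by (simp add: algebra_simps)
  also have "\<dots> = \<beta> * \<beta> * (m * m * (n \<bullet> (A *v n)) + h * h * (p \<bullet> (A *v p)))"
    unfolding l' by (simp add: algebra_simps np0 matrix_vector_mult_minus)
  also have "\<dots> = \<beta> * \<beta> * ((c *\<^sub>R (P \<times> S)) \<bullet> (A *v (c *\<^sub>R (P \<times> S))))"
    unfolding l by (simp add: algebra_simps np0)
  also have "\<dots> = 0"
    using lX by (simp add: matrix_vector_mult_scaleR)
  finally have "(P \<times> T) \<bullet> (A *v (P \<times> T)) = 0" using c by simp
  moreover have "P \<times> T \<noteq> 0"
  proof
    assume "P \<times> T = 0"
    with l' \<beta> have z: "m *\<^sub>R n + h *\<^sub>R p = 0" by simp
    then have "(m *\<^sub>R n + h *\<^sub>R p) \<times> p = 0" by simp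
    then have "m = 0" using np by (simp add: cross_add_left cross_mult_left)
    with z l c l0 show False by auto
  qed
  ultimately show ?thesis by simp
qed

lemma same_conic_other_tangent:
  fixes B :: "real ^ 3 ^ 3" and p s q M :: "real ^ 3"
  assumes symB: "\<And>u v. u \<bullet> (B *v v) = v \<bullet> (B *v u)"
    and on: "p \<bullet> (B *v p) = 0" "s \<bullet> (B *v s) = 0" "q \<bullet> (B *v q) = 0"
    and M: "M \<noteq> 0" "M \<bullet> p = 0" "M \<bullet> s = 0" "M \<bullet> q = 0"
    and qp: "\<And>c. q \<noteq> c *\<^sub>R p" and "s \<noteq> 0"
    and l0: "(B *v p) \<times> (B *v s) \<noteq> 0"
  obtains b where "q = b *\<^sub>R s"
proof -
  have ps: "p \<times> s \<noteq> 0"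
  proof
    assume "p \<times> s = 0"
    then obtain d where "p = d *\<^sub>R s"
      using cross_eq_0_multiple \<open>s \<noteq> 0\<close> by blast
    then show False using l0 by (simp add: matrix_vector_mult_scaleR cross_mult_left)
  qed
  have pS: "p \<bullet> (B *v s) \<noteq> 0"
  proof
    assume z: "p \<bullet> (B *v s) = 0"
    let ?l = "(B *v p) \<times> (B *v s)"
    have "p \<times> ?l = 0" "s \<times> ?l = 0"
      using z on by (simp_all add: Lagrange symB [of s p])
    then obtain d e where "p = d *\<^sub>R ?l" "s = e *\<^sub>R ?l"
      using cross_eq_0_multiple l0 by metis
    then have "p \<times> s = 0"
      by (metis cross_mult_left cross_mult_right cross_refl scaleR_zero_right)
    then show False using ps by simp
  qed
  obtain a b where q: "q = a *\<^sub>R p + b *\<^sub>R s"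
    using concurrent_lines_combination [OF M ps] .
  have "q \<bullet> (B *v q) = 2 * a * b * (p \<bullet> (B *v s))"
    unfolding q by (simp add: algebra_simps on symB [of s p])
  moreover have "b \<noteq> 0" using q qp [of a] by auto
  ultimately have "a = 0" using on(3) pS by simp
  with q have "q = b *\<^sub>R s" by simp
  then show thesis by (rule that)
qed

lemma tangent_line_in_pencil:
  fixes R A D :: "real ^ 3 ^ 3"
  assumes "is_conic R" and k: "k \<noteq> 0"
    and pencil: "\<And>u. k *\<^sub>R (matrix_inv R *v u) = A *v u + r *\<^sub>R (D *v u)"
    and Z: "on_conic R Z"
  defines "z \<equiv> (1 / k) *\<^sub>R (R *v Z)"
  shows "Z = A *v z + r *\<^sub>R (D *v z)" "z \<bullet> Z = 0" "z \<noteq> 0" "Z \<noteq> 0"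
proof -
  have inv: "matrix_inv R *v (R *v Z) = Z"
    by (simp add: matrix_vector_mul_assoc is_conic_inverse(2) [OF assms(1)])
  show "Z = A *v z + r *\<^sub>R (D *v z)"
    unfolding pencil [symmetric] by (simp add: z_def matrix_vector_mult_scaleR inv k)
  show "Z \<noteq> 0" and "z \<bullet> Z = 0"
    using Z by (simp_all add: on_conic_def scalar_product_real z_def inner_commute)
  then show "z \<noteq> 0" using inv k by (auto simp: z_def)
qed

lemma other_touching_point_pencil:
  fixes R :: "real ^ 3 ^ 3"
  assumes "is_conic R" "k \<noteq> 0" "other_touching_point R P M Q"
  shows "on_conic R Q" "M \<bullet> ((1 / k) *\<^sub>R (R *v Q)) = 0"
    "(1 / k) *\<^sub>R (R *v Q) \<noteq> c *\<^sub>R ((1 / k) *\<^sub>R (R *v P))"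
proof -
  show "on_conic R Q" "M \<bullet> ((1 / k) *\<^sub>R (R *v Q)) = 0"
    using assms(3) by (simp_all add: other_touching_point_def incident_def tangent_at_def
        scalar_product_real)
  have ne: "R *v Q \<noteq> 0" and np: "\<not> proj_eq (R *v Q) (R *v P)"
    using assms(3) by (auto simp: other_touching_point_def incident_def tangent_at_def)
  show "(1 / k) *\<^sub>R (R *v Q) \<noteq> c *\<^sub>R ((1 / k) *\<^sub>R (R *v P))"
  proof
    assume "(1 / k) *\<^sub>R (R *v Q) = c *\<^sub>R ((1 / k) *\<^sub>R (R *v P))"
    then have "k *\<^sub>R ((1 / k) *\<^sub>R (R *v Q)) = k *\<^sub>R (c *\<^sub>R ((1 / k) *\<^sub>R (R *v P)))" by simp
    then have eq: "R *v Q = c *s (R *v P)"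
      using assms(2) by (simp add: scalar_mult_eq_scaleR)
    then have "c \<noteq> 0" using ne by auto
    with eq np show False by (auto simp: proj_eq_def)
  qed
qed

text \<open>A real line isotropic for \<open>D\<close> is the line at infinity, which is not tangent to \<open>R\<close>.\<close>

lemma tangent_not_isotropic:
  assumes "A $ 3 $ 3 \<noteq> 0" and "z \<noteq> 0"
    and "z \<bullet> (A *v z + r *\<^sub>R (isotropic_form *v z)) = 0"
  shows "z \<bullet> (isotropic_form *v z) \<noteq> 0"
proof
  assume 0: "z \<bullet> (isotropic_form *v z) = 0"
  then have "z $ 1 = 0 \<and> z $ 2 = 0"
    by (simp add: isotropic_form_vec inner_vec_def sum_3 sum_squares_eq_zero_iff)
  moreover from 0 have "z \<bullet> (A *v z) = 0"
    using assms(3) by (simp add: inner_add_right)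
  ultimately have "z $ 3 = 0"
    using assms(1) by (simp add: inner_vec_def sum_3 matrix_vector_mult_def)
  with \<open>z $ 1 = 0 \<and> z $ 2 = 0\<close> assms(2) show False
    by (simp add: vec_eq_iff forall_3)
qed

lemma proportional_duals_same_points:
  fixes R G :: "real ^ 3 ^ 3"
  assumes "is_conic R" "is_conic G" and k: "k \<noteq> 0" and j: "j \<noteq> 0"
    and eq: "\<And>u. k *\<^sub>R (matrix_inv R *v u) = j *\<^sub>R (matrix_inv G *v u)"
  shows "on_conic R Z \<longleftrightarrow> on_conic G Z"
proof -
  have "matrix_inv R *v (R *v Z) = Z" "G *v (matrix_inv G *v (R *v Z)) = R *v Z"
    using is_conic_inverse [OF assms(1)] is_conic_inverse [OF assms(2)]
    by (simp_all add: matrix_vector_mul_assoc matrix_mul_assoc)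
  then have "k *\<^sub>R (G *v Z) = j *\<^sub>R (R *v Z)"
    using arg_cong [OF eq [of "R *v Z"], of "\<lambda>v. G *v v"]
    by (simp add: matrix_vector_mult_scaleR)
  then have "k * (Z \<bullet> (G *v Z)) = j * (Z \<bullet> (R *v Z))"
    by (metis inner_scaleR_right)
  then show ?thesis
    using k j by (auto simp: on_conic_def scalar_product_real)
qed

theorem theorem4:
  fixes X R G :: "real ^ 3 ^ 3" and P S M Q T :: "real ^ 3"
  assumes "is_ellipse X"
    and "is_conic R" and "confocal R X"
    and "is_conic G" and "confocal G X"
    and "on_conic R P" and "on_conic G S"
    and "is_tangent X (join P S)"
    and "incident M (tangent_at R P)" and "incident M (tangent_at G S)"
    and "other_touching_point R P M Q"
    and "other_touching_point G S M T"
  shows "is_tangent X (join Q T) \<and>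
    (Collect (on_conic R) \<noteq> Collect (on_conic G) \<longrightarrow>
       is_tangent X (join P T) \<and> is_tangent X (join S Q))"
proof -
  define A where "A = matrix_inv X"
  define D where "D = isotropic_form"
  have X: "is_conic X" using assms(1) by (simp add: is_ellipse_def)
  note A33 = ellipse_dual_nonzero [OF assms(1)]
  have symA: "u \<bullet> (A *v v) = v \<bullet> (A *v u)" for u v
    using scalar_product_symmetric [OF is_conic_inverse(3) [OF X]]
    by (simp add: A_def scalar_product_real)
  have symD: "u \<bullet> (D *v v) = v \<bullet> (D *v u)" for u v
    unfolding D_def by (rule isotropic_form_symmetric)
  obtain k r where k: "k \<noteq> 0"
    and Rdual: "\<And>u. k *\<^sub>R (matrix_inv R *v u) = A *v u + r *\<^sub>R (D *v u)"
    using confocal_pencil [OF X assms(2,3) A33] unfolding A_def D_def by blast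
  obtain j g where j: "j \<noteq> 0"
    and Gdual: "\<And>u. j *\<^sub>R (matrix_inv G *v u) = A *v u + g *\<^sub>R (D *v u)"
    using confocal_pencil [OF X assms(4,5) A33] unfolding A_def D_def by blast
  define p where "p = (1 / k) *\<^sub>R (R *v P)"
  define q where "q = (1 / k) *\<^sub>R (R *v Q)"
  define s where "s = (1 / j) *\<^sub>R (G *v S)"
  define t where "t = (1 / j) *\<^sub>R (G *v T)"
  note Q = other_touching_point_pencil [OF assms(2) k assms(11), folded p_def q_def]
  note T = other_touching_point_pencil [OF assms(4) j assms(12), folded s_def t_def]
  note p = tangent_line_in_pencil [OF assms(2) k Rdual assms(6), folded p_def]
  note q = tangent_line_in_pencil [OF assms(2) k Rdual Q(1), folded q_def]
  note s = tangent_line_in_pencil [OF assms(4) j Gdual assms(7), folded s_def]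
  note t = tangent_line_in_pencil [OF assms(4) j Gdual T(1), folded t_def]
  have M: "M \<noteq> 0" "M \<bullet> p = 0" "M \<bullet> s = 0" "M \<bullet> q = 0" "M \<bullet> t = 0"
    using assms(9,10) Q(2) T(2)
    by (simp_all add: incident_def tangent_at_def scalar_product_real p_def s_def)
  have nz: "z \<bullet> (D *v z) \<noteq> 0"
    if "Z = A *v z + c *\<^sub>R (D *v z)" "z \<bullet> Z = 0" "z \<noteq> 0" for z Z c
    using tangent_not_isotropic [OF A33 that(3), of c] that by (simp add: A_def D_def)
  have tangent: "is_tangent X (join U V) \<longleftrightarrow> U \<times> V \<noteq> 0 \<and> (U \<times> V) \<bullet> (A *v (U \<times> V)) = 0" for U V
    by (simp add: is_tangent_iff [OF X] join_def A_def)
  have swap: "is_tangent X (join U V)" if "is_tangent X (join V U)" for U V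
    using that unfolding tangent cross_skew [of U V]
    by (simp add: matrix_vector_mult_minus)
  note PS = assms(8) [unfolded tangent]
  show ?thesis
  proof (cases "r = g")
    case False
    have PT: "is_tangent X (join P T)"
      unfolding tangent
      by (rule reflected_chord_tangent [OF symA symD p(1) s(1) t(1) p(2) s(2) t(2) M(1,2,3,5)
            T(3) nz [OF p(1,2,3)] p(4) s(3) False]) (use PS in auto)
    have "is_tangent X (join S P)" by (rule swap [OF assms(8)])
    then have SQ: "is_tangent X (join S Q)"
      unfolding tangent
      by (intro reflected_chord_tangent [OF symA symD s(1) p(1) q(1) s(2) p(2) q(2) M(1,3,2,4)
            Q(3) nz [OF s(1,2,3)] s(4) p(3)]) (use False in auto)
    have "is_tangent X (join Q S)" by (rule swap [OF SQ])
    then have "is_tangent X (join Q T)"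
      unfolding tangent
      by (intro reflected_chord_tangent [OF symA symD q(1) s(1) t(1) q(2) s(2) t(2) M(1,4,3,5)
            T(3) nz [OF q(1,2,3)] q(4) s(3) False]) auto
    with PT SQ show ?thesis by simp
  next
    case True
    define B where "B = A + r *\<^sub>R D"
    have B: "B *v u = A *v u + r *\<^sub>R (D *v u)" for u
      by (simp add: B_def matrix_vector_mult_add_rdistrib scaleR_matrix_vector_assoc)
    have symB: "u \<bullet> (B *v v) = v \<bullet> (B *v u)" for u v
      by (simp add: B inner_add_right symA [of u] symD [of u])
    have PB: "P = B *v p" "Q = B *v q" "S = B *v s" "T = B *v t"
      using p(1) q(1) s(1) t(1) True by (simp_all add: B)
    obtain b where b: "q = b *\<^sub>R s"
      using same_conic_other_tangent [OF symB _ _ _ M(1,2,3,4) Q(3) s(3)] p(2) q(2) s(2) PS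
      by (metis PB)
    obtain a where a: "t = a *\<^sub>R p"
      using same_conic_other_tangent [OF symB _ _ _ M(1,3,2,5) T(3) p(3)] p(2) t(2) s(2)
        swap [OF assms(8), unfolded tangent]
      by (metis PB)
    have "a \<noteq> 0" "b \<noteq> 0" using a b q(3) t(3) by auto
    moreover have "Q \<times> T = (- (a * b)) *\<^sub>R (P \<times> S)"
      unfolding PB a b
      by (simp add: matrix_vector_mult_scaleR cross_mult_left cross_mult_right
          cross_skew [of "B *v s" "B *v p"])
    ultimately have "is_tangent X (join Q T)"
      unfolding tangent using PS
      by (simp add: matrix_vector_mult_minus matrix_vector_mult_scaleR)
    moreover have "on_conic R Z \<longleftrightarrow> on_conic G Z" for Z
      by (rule proportional_duals_same_points [OF assms(2,4) k j]) (simp add: Rdual Gdual True)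
    ultimately show ?thesis by auto
  qed
qed

end
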